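(* There exists a $3$-dimensional polytope $P\subset\mathbb R^3$ with $10$ vertices such that, for $\mathbf c=(1,0,0)$, the sequence $(N_\ell)_\ell$ of the numbers of $\mathbf c$-monotone paths of length $\ell$ on $P$ is not unimodal.
   Context: For a polytope $P\subset\mathbb R^d$ and $\mathbf c\in\mathbb R^d$ such that $\langle\cdot,\mathbf c\rangle$ attains its minimum and maximum over $P$ at unique vertices $v_{\min}$, $v_{\max}$, let $G_{P,\mathbf c}$ be the directed graph on the vertices of $P$ with an arc $u\to v$ whenever $[u,v]$ is an edge of $P$ with $\langle u,\mathbf c\rangle<\langle v,\mathbf c\rangle$. A $\mathbf c$-monotone path is a directed path in $G_{P,\mathbf c}$ from $v_{\min}$ to $v_{\max}$; its length is its number of edges, and $N_\ell$ is the number of such paths of length $\ell$. A finite sequence $(a_1,\dots,a_r)$ is unimodal if there is $k$ with $a_i\le a_{i+1}$ for $i<k$ and $a_i\ge a_{i+1}$ for $i\ge k$. *)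

theory Defs
  imports "HOL-Analysis.Analysis" "Graph_Theory.Pair_Digraph"
begin

definition vertices :: "(real ^ 'd) set \<Rightarrow> (real ^ 'd) set" where
  "vertices P = {v. v extreme_point_of P}"

definition unique_min_vertex :: "(real ^ 'd) set \<Rightarrow> real ^ 'd \<Rightarrow> real ^ 'd \<Rightarrow> bool" where
  "unique_min_vertex P c v \<longleftrightarrow> v \<in> vertices P \<and> (\<forall>x\<in>P. x \<noteq> v \<longrightarrow> v \<bullet> c < x \<bullet> c)"

definition unique_max_vertex :: "(real ^ 'd) set \<Rightarrow> real ^ 'd \<Rightarrow> real ^ 'd \<Rightarrow> bool" where
  "unique_max_vertex P c v \<longleftrightarrow> v \<in> vertices P \<and> (\<forall>x\<in>P. x \<noteq> v \<longrightarrow> x \<bullet> c < v \<bullet> c)"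

definition monotone_digraph ::
    "(real ^ 'd) set \<Rightarrow> real ^ 'd \<Rightarrow> (real ^ 'd) pair_pre_digraph" where
  "monotone_digraph P c =
     \<lparr> pverts = vertices P,
       parcs = {(u, v). u \<in> vertices P \<and> v \<in> vertices P \<and>
                        closed_segment u v edge_of P \<and> u \<bullet> c < v \<bullet> c} \<rparr>"

text \<open>A path is represented by its list of arcs, so the length of the list is the number of edges.\<close>

definition monotone_path ::
    "(real ^ 'd) set \<Rightarrow> real ^ 'd \<Rightarrow> ((real ^ 'd) \<times> (real ^ 'd)) list \<Rightarrow> bool" where
  "monotone_path P c p \<longleftrightarrow>
     (\<exists>vmin vmax. unique_min_vertex P c vmin \<and> unique_max_vertex P c vmax \<and>
        pre_digraph.apath (with_proj (monotone_digraph P c)) vmin p vmax)"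

definition num_monotone_paths :: "(real ^ 'd) set \<Rightarrow> real ^ 'd \<Rightarrow> nat \<Rightarrow> nat" where
  "num_monotone_paths P c l = card {p. monotone_path P c p \<and> length p = l}"

text \<open>A path visits each vertex at most once, so every possible length is smaller than the number
  of vertices; the sequence below therefore lists all the path numbers that can be nonzero.\<close>

definition monotone_path_sequence :: "(real ^ 'd) set \<Rightarrow> real ^ 'd \<Rightarrow> nat list" where
  "monotone_path_sequence P c = map (num_monotone_paths P c) [0..<card (vertices P)]"

definition unimodal :: "'a::linorder list \<Rightarrow> bool" where
  "unimodal a \<longleftrightarrow>
     (\<exists>k. \<forall>i. Suc i < length a \<longrightarrow>
        (i < k \<longrightarrow> a ! i \<le> a ! Suc i) \<and> (k \<le> i \<longrightarrow> a ! Suc i \<le> a ! i))"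

end

theory Submission
  imports Defs
begin

text \<open>
  If the minimal and the maximal vertex are joined by an edge but have no common neighbour, then
  \<open>N\<^sub>1 = 1\<close> and \<open>N\<^sub>2 = 0\<close>, so a single monotone path of length 3 destroys unimodality. This happens
  for the pentagonal prism \<open>{(x, q). q \<in> Q \<and> s(q) \<le> x \<le> 8 - s(q)}\<close> with slanted bases, where \<open>Q\<close> is a
  pentagon with a vertex at the origin and \<open>s(y, z) = y + z\<close>. The extreme vertices are \<open>(0, 0, 0)\<close>
  and \<open>(8, 0, 0)\<close>. Over any other vertex \<open>q\<close> of \<open>Q\<close>, the points \<open>(s(q), q)\<close> and \<open>(8 - s(q), q)\<close>
  form a trapezoid together with them, and its crossing diagonals are not edges.
\<close>

section \<open>Faces of convex hulls exposed by linear functionals\<close>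

text \<open>The hyperplane \<open>a \<bullet> x = b\<close> contains the affine hull of
  \<open>T\<close>, while the hull of the remaining points stays in the open halfspace below it. The
  two are therefore disjoint, which is the face criterion of
  \<open>face_of_convex_hulls\<close>.\<close>

lemma convex_hull_face_of_convex_hull:
  fixes V :: "'a::euclidean_space set"
  assumes "finite V" "T \<subseteq> V"
    and eq: "\<And>v. v \<in> T \<Longrightarrow> a \<bullet> v = b"
    and less: "\<And>v. v \<in> V - T \<Longrightarrow> a \<bullet> v < b"
  shows "convex hull T face_of convex hull V"
proof (rule face_of_convex_hulls)
  have "affine hull T \<subseteq> {x. a \<bullet> x = b}"
    by (rule hull_minimal) (auto simp: eq affine_hyperplane)
  moreover have "convex hull (V - T) \<subseteq> {x. a \<bullet> x < b}"
    by (rule hull_minimal) (use less in \<open>auto simp: convex_halfspace_lt\<close>)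
  ultimately show "affine hull T \<inter> convex hull (V - T) = {}"
    by fastforce
qed (use assms in auto)

lemma vertex_of_convex_hullI:
  fixes V :: "(real ^ 'd) set"
  assumes "finite V" "v \<in> V" "\<And>w. w \<in> V \<Longrightarrow> w \<noteq> v \<Longrightarrow> a \<bullet> w < a \<bullet> v"
  shows "v \<in> vertices (convex hull V)"
  using convex_hull_face_of_convex_hull[of V "{v}" a "a \<bullet> v"] assms
  by (auto simp: vertices_def face_of_singleton)

lemma edge_of_convex_hullI:
  fixes V :: "(real ^ 'd) set"
  assumes "finite V" "u \<in> V" "v \<in> V" "u \<noteq> v" "a \<bullet> u = a \<bullet> v"
    and "\<And>w. w \<in> V \<Longrightarrow> w \<noteq> u \<Longrightarrow> w \<noteq> v \<Longrightarrow> a \<bullet> w < a \<bullet> v"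
  shows "closed_segment u v edge_of (convex hull V)"
proof -
  have "convex hull {u, v} face_of convex hull V"
    by (rule convex_hull_face_of_convex_hull[where a = a and b = "a \<bullet> v"]) (use assms in auto)
  moreover have "aff_dim (convex hull {u, v}) = 1"
    using \<open>u \<noteq> v\<close> by (simp only: aff_dim_convex_hull aff_dim_2 if_False)
  ultimately show ?thesis
    by (simp only: edge_of_def segment_convex_hull simp_thms)
qed

lemma vertices_convex_hull_subset: "vertices (convex hull V) \<subseteq> V"
  by (auto simp: vertices_def extreme_point_of_convex_hull)

text \<open>The strict inequality passes from the generators to the whole hull because an open
  halfspace together with one boundary point is still convex.\<close>

lemma unique_min_vertex_convex_hullI:
  fixes V :: "(real ^ 'd) set"
  assumes "finite V" "v \<in> V" and less: "\<And>w. w \<in> V \<Longrightarrow> w \<noteq> v \<Longrightarrow> v \<bullet> c < w \<bullet> c"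
  shows "unique_min_vertex (convex hull V) c v"
proof -
  have vert: "v \<in> vertices (convex hull V)"
    by (rule vertex_of_convex_hullI[where a = "- c"]) (use assms in \<open>auto simp: inner_commute\<close>)
  have "convex hull V \<subseteq> insert v {x. c \<bullet> v < c \<bullet> x}"
  proof (rule hull_minimal)
    show "convex (insert v {x. c \<bullet> v < c \<bullet> x})"
    proof (rule convexI)
      fix x y :: "real ^ 'd" and s t :: real
      assume x: "x \<in> insert v {x. c \<bullet> v < c \<bullet> x}" and y: "y \<in> insert v {x. c \<bullet> v < c \<bullet> x}"
        and st: "0 \<le> s" "0 \<le> t" "s + t = 1"
      \<comment> \<open>As \<open>s + t = 1\<close>, the excess over the value at \<open>v\<close>
        is the weighted sum of two nonnegative excesses, so one positive term suffices.\<close>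
      have gap: "c \<bullet> (s *\<^sub>R x + t *\<^sub>R y) - c \<bullet> v = s * (c \<bullet> x - c \<bullet> v) + t * (c \<bullet> y - c \<bullet> v)"
        unfolding eq_diff_eq[THEN iffD2, OF st(3)] by (simp add: algebra_simps)
      consider "s = 0" | "t = 0" | "x = v" "y = v"
        | "0 < s" "0 < t" "c \<bullet> v < c \<bullet> x \<or> c \<bullet> v < c \<bullet> y"
        using st(1,2) x y by (cases "s = 0"; cases "t = 0"; cases "x = v"; cases "y = v") simp_all
      then show "s *\<^sub>R x + t *\<^sub>R y \<in> insert v {x. c \<bullet> v < c \<bullet> x}"
      proof cases
        case 4
        then have "0 < s * (c \<bullet> x - c \<bullet> v) + t * (c \<bullet> y - c \<bullet> v)"
          using x y by (auto intro: add_pos_pos)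
        then show ?thesis using gap by simp
      qed (use st x y in \<open>auto simp flip: scaleR_left_distrib\<close>)
    qed
  qed (use less in \<open>auto simp: inner_commute\<close>)
  then show ?thesis
    using vert by (auto simp: unique_min_vertex_def inner_commute)
qed

lemma unique_max_vertex_iff: "unique_max_vertex P c v \<longleftrightarrow> unique_min_vertex P (- c) v"
  by (simp add: unique_max_vertex_def unique_min_vertex_def)

lemma unique_min_vertex_unique:
  "unique_min_vertex P c u \<Longrightarrow> unique_min_vertex P c v \<Longrightarrow> u = v"
  by (force simp: unique_min_vertex_def vertices_def extreme_point_of_def)

lemma unique_max_vertex_unique:
  "unique_max_vertex P c u \<Longrightarrow> unique_max_vertex P c v \<Longrightarrow> u = v"
  using unique_min_vertex_unique unique_max_vertex_iff by blast

section \<open>Counting monotone paths and refuting unimodality\<close>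

lemma finite_monotone_paths:
  assumes "finite (vertices P)"
  shows "finite {p. monotone_path P c p \<and> length p = l}"
proof (rule finite_subset)
  show "{p. monotone_path P c p \<and> length p = l}
    \<subseteq> {p. set p \<subseteq> vertices P \<times> vertices P \<and> length p = l}"
    by (auto simp: monotone_path_def monotone_digraph_def pre_digraph.apath_def
        pre_digraph.awalk_def)
  show "finite {p. set p \<subseteq> vertices P \<times> vertices P \<and> length p = l}"
    using assms by (intro finite_lists_length_eq) auto
qed

text \<open>Finiteness matters here: \<open>card\<close> of an infinite set is 0, so exhibiting a
  path would not by itself give a positive count.\<close>

lemma num_monotone_paths_pos:
  assumes "finite (vertices P)" "monotone_path P c p"
  shows "0 < num_monotone_paths P c (length p)"
  using finite_monotone_paths[OF assms(1)] assms(2)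
  by (auto simp: num_monotone_paths_def card_gt_0_iff)

text \<open>A peak position \<open>k > i\<close> is refuted by the descent at \<open>i\<close>; a
  peak position \<open>k \<le> i < j\<close> is refuted by the ascent at \<open>j\<close>.\<close>

lemma not_unimodalI:
  assumes "i < j" "Suc j < length a" "a ! Suc i < a ! i" "a ! j < a ! Suc j"
  shows "\<not> unimodal a"
proof
  assume "unimodal a"
  then obtain k where k: "\<And>i. Suc i < length a \<Longrightarrow>
      (i < k \<longrightarrow> a ! i \<le> a ! Suc i) \<and> (k \<le> i \<longrightarrow> a ! Suc i \<le> a ! i)"
    unfolding unimodal_def by blast
  show False
    using k[of i] k[of j] assms by (cases "i < k") auto
qed

section \<open>The slanted pentagonal prism\<close>

text \<open>The first row is the base \<open>x = y + z\<close>; the second is its mirror image under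
  \<open>x\<close> to \<open>8 - x\<close>. Triples are used so that membership and equality reduce
  to arithmetic on numerals.\<close>

definition prism_coords :: "(real \<times> real \<times> real) set" where
  "prism_coords =
    {(0,0,0), (2,2,0), (3,2,1), (3,1,2), (2,0,2),
     (8,0,0), (6,2,0), (5,2,1), (5,1,2), (6,0,2)}"

definition prism_vertices :: "(real ^ 3) set" where
  "prism_vertices = (\<lambda>(x, y, z). vector [x, y, z]) ` prism_coords"

lemma vector3_eq_iff:
  "(vector [x, y, z] :: 'a::zero ^ 3) = vector [x', y', z'] \<longleftrightarrow> x = x' \<and> y = y' \<and> z = z'"
  by (simp add: vec_eq_iff forall_3)

lemma vector3_zero: "(vector [0, 0, 0] :: 'a::zero ^ 3) = 0"
  by (simp add: vec_eq_iff forall_3)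

lemma inner_vector3:
  "(vector [x, y, z] :: real ^ 3) \<bullet> vector [x', y', z'] = x * x' + y * y' + z * z'"
  by (simp add: inner_vec_def sum_3)

lemma vector_mem_prism_vertices_iff [simp]:
  "vector [x, y, z] \<in> prism_vertices \<longleftrightarrow> (x, y, z) \<in> prism_coords"
  by (force simp: prism_vertices_def vector3_eq_iff)

lemma prism_verticesE:
  assumes "v \<in> prism_vertices"
  obtains x y z where "v = vector [x, y, z]" "(x, y, z) \<in> prism_coords"
  using assms by (auto simp: prism_vertices_def)

lemma finite_prism_vertices: "finite prism_vertices"
  by (simp add: prism_vertices_def prism_coords_def)

lemma card_prism_vertices: "card prism_vertices = 10"
proof -
  have "card prism_vertices = card prism_coords"
    unfolding prism_vertices_def
    by (rule card_image) (auto simp: inj_on_def vector3_eq_iff)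
  then show ?thesis by (simp add: prism_coords_def)
qed

lemma vertices_prism: "vertices (convex hull prism_vertices) = prism_vertices"
proof
  have vert: "vector [x, y, z] \<in> vertices (convex hull prism_vertices)"
    if "(x, y, z) \<in> prism_coords"
      "\<forall>(x', y', z') \<in> prism_coords. (x', y', z') = (x, y, z) \<or>
         a * x' + b * y' + d * z' < a * x + b * y + d * z"
    for x y z a b d
    by (rule vertex_of_convex_hullI[where a = "vector [a, b, d]", OF finite_prism_vertices])
      (use that in \<open>auto simp: inner_vector3 elim!: prism_verticesE\<close>)
  have "\<forall>(x, y, z) \<in> prism_coords. vector [x, y, z] \<in> vertices (convex hull prism_vertices)"
    \<comment> \<open>The last three arguments are a functional. Its \<open>y\<close> and
      \<open>z\<close> coefficients single out a vertex of the pentagon by a margin exceeding the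
      range of \<open>x\<close>; the sign of its \<open>x\<close> coefficient picks one of the two
      bases.\<close>
    using vert[of 0 0 0 "-1" "-10" "-10"] vert[of 8 0 0 1 "-10" "-10"]
      vert[of 2 2 0 "-1" 10 "-10"] vert[of 6 2 0 1 10 "-10"]
      vert[of 3 2 1 "-1" 20 10] vert[of 5 2 1 1 20 10]
      vert[of 3 1 2 "-1" 10 20] vert[of 5 1 2 1 10 20]
      vert[of 2 0 2 "-1" "-10" 10] vert[of 6 0 2 1 "-10" 10]
    by (simp add: prism_coords_def)
  then show "prism_vertices \<subseteq> vertices (convex hull prism_vertices)"
    by (auto elim!: prism_verticesE)
qed (rule vertices_convex_hull_subset)

lemma edge_of_prism:
  assumes "(x, y, z) \<in> prism_coords" "(x', y', z') \<in> prism_coords" "(x, y, z) \<noteq> (x', y', z')"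
    and "a * x + b * y + d * z = a * x' + b * y' + d * z'"
    and "\<forall>(x'', y'', z'') \<in> prism_coords. (x'', y'', z'') = (x, y, z) \<or>
      (x'', y'', z'') = (x', y', z') \<or> a * x'' + b * y'' + d * z'' < a * x' + b * y' + d * z'"
  shows "closed_segment (vector [x, y, z]) (vector [x', y', z']) edge_of convex hull prism_vertices"
  by (rule edge_of_convex_hullI[where a = "vector [a, b, d]", OF finite_prism_vertices])
    (use assms in \<open>auto simp: inner_vector3 vector3_eq_iff elim!: prism_verticesE\<close>)

text \<open>The origin is one of the points, so their affine hull equals their linear span, and
  three of the points already span the space.\<close>

lemma aff_dim_prism: "aff_dim (convex hull prism_vertices) = 3"
proof -
  let ?S = "span prism_vertices"
  have mem: "vector [x, y, z] \<in> ?S" if "(x, y, z) \<in> prism_coords" for x y z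
    using that by (simp add: span_base)
  have "v \<in> ?S" for v :: "real ^ 3"
  proof -
    let ?p = "vector [8, 0, 0] :: real ^ 3" and ?q = "vector [2, 2, 0] :: real ^ 3"
      and ?r = "vector [2, 0, 2] :: real ^ 3"
    have "v = ((v $ 1 - v $ 2 - v $ 3) / 8) *\<^sub>R ?p + (v $ 2 / 2) *\<^sub>R ?q + (v $ 3 / 2) *\<^sub>R ?r"
      by (simp add: vec_eq_iff forall_3 field_simps)
    also have "\<dots> \<in> ?S"
      by (intro span_add span_scale mem) (auto simp: prism_coords_def)
    finally show ?thesis .
  qed
  then have "?S = UNIV" by auto
  moreover have "0 \<in> prism_vertices"
    using vector_mem_prism_vertices_iff[of 0 0 0]
    by (simp add: prism_coords_def flip: vector3_zero)
  then have "0 \<in> affine hull prism_vertices"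
    by (rule hull_inc)
  ultimately have "affine hull prism_vertices = UNIV"
    by (simp add: affine_hull_span_0)
  then have "aff_dim prism_vertices = aff_dim (UNIV :: (real ^ 3) set)"
    by (metis aff_dim_affine_hull)
  then show ?thesis
    by (simp add: aff_dim_convex_hull)
qed

section \<open>Diagonals that are not edges\<close>

text \<open>The diagonals are exchanged by the reflection \<open>x\<close> to \<open>8 - x\<close>,
  so they meet in the mirror plane \<open>x = 4\<close>.\<close>

lemma crossing_trapezoid_diagonals:
  fixes s y z :: real
  assumes "0 < s" "s < 4" "y \<noteq> 0 \<or> z \<noteq> 0"
  obtains p :: "real ^ 3"
  where "p \<in> open_segment (vector [s, y, z]) (vector [8, 0, 0])"
    and "p \<in> open_segment (vector [0, 0, 0]) (vector [8 - s, y, z])"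
proof -
  \<comment> \<open>Solves \<open>(1 - t) * s + t * 8 = 4\<close>.\<close>
  define t where "t = (4 - s) / (8 - s)"
  have t: "0 < t" "t < 1" "t * (8 - s) = 4 - s"
    using assms by (auto simp: t_def)
  let ?p = "(1 - t) *\<^sub>R vector [s, y, z] + t *\<^sub>R vector [8, 0, 0] :: real ^ 3"
  have "?p = (1 - (1 - t)) *\<^sub>R vector [0, 0, 0] + (1 - t) *\<^sub>R vector [8 - s, y, z]"
    using t(3) by (simp add: vec_eq_iff forall_3 algebra_simps)
  then have "?p \<in> open_segment (vector [0, 0, 0]) (vector [8 - s, y, z])"
    unfolding in_segment(2) vector3_eq_iff using t(1,2) assms
    by (intro conjI exI[of _ "1 - t"]) auto
  moreover have "?p \<in> open_segment (vector [s, y, z]) (vector [8, 0, 0])"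
    unfolding in_segment(2) vector3_eq_iff using t(1,2) assms by auto
  ultimately show ?thesis using that by blast
qed

text \<open>If one diagonal were a face, it would contain both ends of the other, since the crossing
  point is interior to that one. But \<open>x \<ge> s > 0\<close> on the first diagonal excludes the
  origin, and \<open>x \<le> 8 - s < 8\<close> on the second excludes
  \<open>(8, 0, 0)\<close>.\<close>

lemma not_edge_of_prism:
  assumes "s = y + z" "(s, y, z) \<in> prism_coords" "(8 - s, y, z) \<in> prism_coords" "0 < s" "s < 4"
  shows "\<not> closed_segment (vector [s, y, z]) (vector [8, 0, 0]) edge_of convex hull prism_vertices"
    and "\<not> closed_segment (vector [0, 0, 0]) (vector [8 - s, y, z])
           edge_of convex hull prism_vertices"
proof -
  have in_hull: "vector [x, y, z] \<in> convex hull prism_vertices"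
    if "(x, y, z) \<in> prism_coords" for x y z
    using that by (simp add: hull_inc)
  have ends: "vector [0, 0, 0] \<in> convex hull prism_vertices"
    "vector [8, 0, 0] \<in> convex hull prism_vertices"
    by (auto intro!: in_hull simp: prism_coords_def)
  have "y \<noteq> 0 \<or> z \<noteq> 0" using assms by auto
  then obtain p :: "real ^ 3" where
    p: "p \<in> open_segment (vector [s, y, z]) (vector [8, 0, 0])"
      "p \<in> open_segment (vector [0, 0, 0]) (vector [8 - s, y, z])"
    using crossing_trapezoid_diagonals[of s y z] assms by blast
  show "\<not> closed_segment (vector [s, y, z]) (vector [8, 0, 0]) edge_of convex hull prism_vertices"
  proof
    assume "closed_segment (vector [s, y, z]) (vector [8, 0, 0]) edge_of convex hull prism_vertices"
    then have "(vector [0, 0, 0] :: real ^ 3) \<in> closed_segment (vector [s, y, z]) (vector [8, 0, 0])"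
      using p ends in_hull[OF assms(3)] unfolding edge_of_def face_of_def
      by (meson open_closed_segment)
    then obtain u where u: "0 \<le> u" "u \<le> 1"
      "(vector [0, 0, 0] :: real ^ 3) = (1 - u) *\<^sub>R vector [s, y, z] + u *\<^sub>R vector [8, 0, 0]"
      by (auto simp: in_segment)
    then have "0 = (1 - u) * s + u * 8"
      by (simp add: vec_eq_iff forall_3)
    moreover have "0 \<le> (1 - u) * s" using u assms by simp
    ultimately have "u = 0" using u by linarith
    then show False using \<open>0 = (1 - u) * s + u * 8\<close> assms by simp
  qed
  show "\<not> closed_segment (vector [0, 0, 0]) (vector [8 - s, y, z])
          edge_of convex hull prism_vertices"
  proof
    assume "closed_segment (vector [0, 0, 0]) (vector [8 - s, y, z])
      edge_of convex hull prism_vertices"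
    then have "(vector [8, 0, 0] :: real ^ 3)
        \<in> closed_segment (vector [0, 0, 0]) (vector [8 - s, y, z])"
      using p ends in_hull[OF assms(2)] unfolding edge_of_def face_of_def
      by (meson open_closed_segment)
    then obtain u where u: "0 \<le> u" "u \<le> 1"
      "(vector [8, 0, 0] :: real ^ 3) = (1 - u) *\<^sub>R vector [0, 0, 0] + u *\<^sub>R vector [8 - s, y, z]"
      by (auto simp: in_segment)
    then have "8 = u * (8 - s)"
      by (simp add: vec_eq_iff forall_3)
    moreover have "u * (8 - s) \<le> 8 - s"
      using u assms by (simp add: mult_left_le_one_le)
    ultimately show False using assms by linarith
  qed
qed

text \<open>If \<open>w\<close> is an extreme vertex, one of the segments is a single point.
  Otherwise one of them is a trapezoid diagonal: the segment to \<open>(8, 0, 0)\<close> when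
  \<open>w\<close> is on the first base, the segment from the origin when it is on the
  second.\<close>

lemma no_common_neighbour:
  assumes "w \<in> prism_vertices"
  shows "\<not> (closed_segment (vector [0, 0, 0]) w edge_of convex hull prism_vertices \<and>
            closed_segment w (vector [8, 0, 0]) edge_of convex hull prism_vertices)"
proof -
  have no_loop: "\<not> closed_segment v v edge_of convex hull prism_vertices" for v
    by (simp add: edge_of_def)
  obtain x y z where w: "w = vector [x, y, z]" and xyz: "(x, y, z) \<in> prism_coords"
    using assms by (rule prism_verticesE)
  from xyz consider "(x, y, z) = (0, 0, 0)" | "(x, y, z) = (8, 0, 0)"
    | "x = y + z" "(8 - x, y, z) \<in> prism_coords" "0 < x" "x < 4"
    | "8 - x = y + z" "(8 - x, y, z) \<in> prism_coords" "0 < 8 - x" "8 - x < 4"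
    unfolding prism_coords_def by (elim insertE emptyE) simp_all
  then show ?thesis
  proof cases
    case 3
    then show ?thesis using not_edge_of_prism(1)[of x y z] xyz w by blast
  next
    case 4
    moreover have "8 - (8 - x) = x" by simp
    ultimately show ?thesis using not_edge_of_prism(2)[of "8 - x" y z] xyz w by metis
  qed (use no_loop w in auto)
qed

theorem theorem4p7:
  fixes c :: "real ^ 3"
  assumes "c = vector [1, 0, 0]"
  shows "\<exists>P :: (real ^ 3) set.
           polytope P \<and> aff_dim P = 3 \<and> card (vertices P) = 10 \<and>
           (\<exists>v. unique_min_vertex P c v) \<and> (\<exists>v. unique_max_vertex P c v) \<and>
           \<not> unimodal (monotone_path_sequence P c)"
proof -
  let ?P = "convex hull prism_vertices"
  let ?e = "vector [0, 0, 0] :: real ^ 3" and ?f = "vector [8, 0, 0] :: real ^ 3"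
  \<comment> \<open>These give the path of length 3: along one base, across an edge parallel to the
    \<open>x\<close> axis, then along the other base.\<close>
  let ?a = "vector [2, 2, 0] :: real ^ 3" and ?b = "vector [6, 2, 0] :: real ^ 3"
  have min: "unique_min_vertex ?P c ?e"
    by (rule unique_min_vertex_convex_hullI[OF finite_prism_vertices])
      (auto simp: prism_vertices_def prism_coords_def assms inner_vector3)
  have max: "unique_max_vertex ?P c ?f"
    unfolding unique_max_vertex_iff
    by (rule unique_min_vertex_convex_hullI[OF finite_prism_vertices])
      (auto simp: prism_vertices_def prism_coords_def assms inner_vector3)
  have verts: "?e \<in> prism_vertices" "?f \<in> prism_vertices" "?a \<in> prism_vertices"
    "?b \<in> prism_vertices"
    by (simp_all add: prism_coords_def)
  have edges: "closed_segment ?e ?f edge_of ?P" "closed_segment ?e ?a edge_of ?P"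
    "closed_segment ?a ?b edge_of ?P" "closed_segment ?b ?f edge_of ?P"
    \<comment> \<open>The last three arguments are a functional maximised over the prism exactly on
      the edge, such as \<open>- x + y - z\<close> with maximum 0 for the second one.\<close>
    using edge_of_prism[of 0 0 0 8 0 0 0 "-1" "-1"] edge_of_prism[of 0 0 0 2 2 0 "-1" 1 "-1"]
      edge_of_prism[of 2 2 0 6 2 0 0 1 "-1"] edge_of_prism[of 6 2 0 8 0 0 1 1 "-1"]
    by (auto simp: prism_coords_def)
  note walk_simps = pre_digraph.apath_def pre_digraph.awalk_def pre_digraph.awalk_verts.simps
    pre_digraph.cas.simps monotone_digraph_def vertices_prism
  have path1: "monotone_path ?P c [(?e, ?f)]"
    unfolding monotone_path_def using min max verts edges
    by (intro exI[of _ ?e] exI[of _ ?f])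
      (auto simp: walk_simps assms inner_vector3 vector3_eq_iff)
  have path3: "monotone_path ?P c [(?e, ?a), (?a, ?b), (?b, ?f)]"
    unfolding monotone_path_def using min max verts edges
    by (intro exI[of _ ?e] exI[of _ ?f])
      (auto simp: walk_simps assms inner_vector3 vector3_eq_iff)
  have "\<not> monotone_path ?P c p" if len: "length p = 2" for p
  proof
    assume "monotone_path ?P c p"
    then have walk: "pre_digraph.apath (with_proj (monotone_digraph ?P c)) ?e p ?f"
      using min max unique_min_vertex_unique unique_max_vertex_unique
      unfolding monotone_path_def by blast
    obtain u v u' v' where p: "p = [(u, v), (u', v')]"
      using len by (auto simp: numeral_2_eq_2 length_Suc_conv)
    show False
      \<comment> \<open>Consecutive arcs force \<open>v = u'\<close>, so \<open>v\<close> would be a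
        common neighbour of the extreme vertices.\<close>
      using walk no_common_neighbour[of v] unfolding p by (auto simp: walk_simps)
  qed
  then have N2: "num_monotone_paths ?P c 2 = 0"
    unfolding num_monotone_paths_def by (metis (mono_tags, lifting) card.empty Collect_empty_eq)
  have fin: "finite (vertices ?P)"
    by (simp add: vertices_prism finite_prism_vertices)
  have "\<not> unimodal (monotone_path_sequence ?P c)"
    using num_monotone_paths_pos[OF fin path1] num_monotone_paths_pos[OF fin path3] N2
    \<comment> \<open>The sequence starts with \<open>N_0\<close>, so list position and path length
      agree: the descent is from \<open>N_1\<close> to \<open>N_2\<close>, the ascent from
      \<open>N_2\<close> to \<open>N_3\<close>.\<close>
    by (intro not_unimodalI[of 1 2])
      (auto simp: monotone_path_sequence_def vertices_prism card_prism_vertices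
        numeral_2_eq_2 numeral_3_eq_3)
  then show ?thesis
    using min max aff_dim_prism finite_prism_vertices
    by (intro exI[of _ ?P])
      (auto simp: vertices_prism card_prism_vertices intro: polytope_convex_hull)
qed

end
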